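(* Consider data generating processes satisfying randomization and the strong surrogate assumption (as defined in the context), and suppose the observed quantities $\{P(S,Y\mid T=0),\,P(S\mid T=1),\,\gamma\}$ are known, where $\gamma=\mathrm{ACE}(S\rightarrow Y)$ (that is, these quantities are given values which are produced by at least one such process). Write $p_{ys}=P(Y=y,S=s\mid T=0)$ and $r_s=P(S=s\mid T=1)$ for $y,s\in\{0,1\}$. Then the sharp bounds for $\mathrm{ACE}(T\rightarrow Y)$ are $[L,U]$, where $$L=\max\{-p_{10}-r_0,\; -P(Y=1\mid T=0),\; -p_{11}-r_1,\; -\gamma-r_1-p_{10},\; -\gamma-p_{01}-2p_{10},\; \gamma-2p_{11}-p_{00},\; \gamma-r_0-p_{11}\}$$ and $$U=\min\{p_{00}+r_0,\; P(Y=0\mid T=0),\; p_{01}+r_1,\; \gamma+p_{10}+2p_{01},\; \gamma+p_{01}+r_0,\; -\gamma+2p_{00}+p_{11},\; -\gamma+p_{00}+r_1\}.$$ That is, every such process with these observed quantities satisfies $L\le \mathrm{ACE}(T\rightarrow Y)\le U$, and each of the values $L$ and $U$ is attained by some such process with the same observed quantities.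
   Context: $T$ (treatment), $S$ (surrogate), $Y$ (primary outcome) are binary, with values in $\{0,1\}$; $U$ is an unobserved confounder of $S$ and $Y$ taking values in an arbitrary space, with no restriction on its distribution or on how it affects $S$ and $Y$ (in this problem the letter $U$ also denotes the upper bound; the two are unrelated). $S_t$ is the potential value of $S$ when $T$ is set to $t$; $Y_{ts}$ is the potential value of $Y$ when $T$ is set to $t$ and $S$ to $s$; $Y_{T=t}=Y_{t,S_t}$ is the potential value of $Y$ when only $T$ is set to $t$. Observed values are $S=S_T$ and $Y=Y_{T=T}=Y_{T,S_T}$. It is assumed that $0<P(T=1)<1$. Randomization: $T$ is independent of $(Y_{00},Y_{01},Y_{10},Y_{11},S_0,S_1,U)$. Strong surrogate assumption: the causal diagram with edges exactly $T\to S$, $S\to Y$, $U\to S$, $U\to Y$ is valid. In particular $Y_{ts}$ does not depend on $t$, and one writes $Y_{ts}=Y_s$, so $Y_{T=t}=Y_{S_t}$. Since $U$ is unrestricted, the joint distribution of the binary vector $(Y_0,Y_1,S_0,S_1)$ can be an arbitrary probability distribution on $\{0,1\}^4$, and $T$ is independent of it. Average causal effects: $\mathrm{ACE}(T\rightarrow Y)=P(Y_{T=1}=1)-P(Y_{T=0}=1)$, and $\gamma=\mathrm{ACE}(S\rightarrow Y)=P(Y_{1}=1)-P(Y_{0}=1)$, where $Y_s$ denotes the potential outcome with $S$ set to $s$. *)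

theory Defs
  imports "HOL-Probability.Probability"
begin

abbreviation binary :: "nat measure" where
  "binary \<equiv> count_space {0, 1}"

text \<open>
  \<^const>\<open>prob_space.indep_var\<close> forces both variables to have the same value type, so independence of
  differently typed variables is expressed through the sigma-algebras they generate.
\<close>

definition indep_rv ::
  "'w measure \<Rightarrow> 'a measure \<Rightarrow> ('w \<Rightarrow> 'a) \<Rightarrow> 'b measure \<Rightarrow> ('w \<Rightarrow> 'b) \<Rightarrow> bool" where
  "indep_rv M A X B Z \<longleftrightarrow>
     prob_space.indep_set M (sets (vimage_algebra (space M) X A)) (sets (vimage_algebra (space M) Z B))"

definition cond_indep_rv ::
  "'w measure \<Rightarrow> 'a measure \<Rightarrow> ('w \<Rightarrow> 'a) \<Rightarrow> 'b measure \<Rightarrow> ('w \<Rightarrow> 'b) \<Rightarrow> 'c measure \<Rightarrow> ('w \<Rightarrow> 'c) \<Rightarrow> bool"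
  where
  "cond_indep_rv M A X B Z C V \<longleftrightarrow>
     (\<forall>E \<in> sets (vimage_algebra (space M) X A). \<forall>F \<in> sets (vimage_algebra (space M) Z B).
        AE \<omega> in M.
          real_cond_exp M (vimage_algebra (space M) V C) (indicator (E \<inter> F)) \<omega> =
          real_cond_exp M (vimage_algebra (space M) V C) (indicator E) \<omega> *
          real_cond_exp M (vimage_algebra (space M) V C) (indicator F) \<omega>)"

text \<open>
  \<open>sur P t\<close> is the potential surrogate under treatment \<open>t\<close>; \<open>out P t s\<close> is the potential outcome
  under treatment \<open>t\<close> and surrogate \<open>s\<close>. Only indices in \<open>{0, 1}\<close> are meaningful.
\<close>

record ('w, 'u) process =
  pr  :: "'w measure"
  trt :: "'w \<Rightarrow> nat"
  sur :: "nat \<Rightarrow> 'w \<Rightarrow> nat"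
  out :: "nat \<Rightarrow> nat \<Rightarrow> 'w \<Rightarrow> nat"
  cnf_space :: "'u measure"
  cnf :: "'w \<Rightarrow> 'u"

definition wf_process :: "('w, 'u) process \<Rightarrow> bool" where
  "wf_process P \<longleftrightarrow>
     prob_space (pr P) \<and>
     trt P \<in> pr P \<rightarrow>\<^sub>M binary \<and>
     (\<forall>t\<in>{0, 1}. sur P t \<in> pr P \<rightarrow>\<^sub>M binary) \<and>
     (\<forall>t\<in>{0, 1}. \<forall>s\<in>{0, 1}. out P t s \<in> pr P \<rightarrow>\<^sub>M binary) \<and>
     cnf P \<in> pr P \<rightarrow>\<^sub>M cnf_space P \<and>
     0 < \<P>(\<omega> in pr P. trt P \<omega> = 1) \<and> \<P>(\<omega> in pr P. trt P \<omega> = 1) < 1"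

definition sur_vec :: "('w, 'u) process \<Rightarrow> 'w \<Rightarrow> nat \<times> nat" where
  "sur_vec P \<omega> = (sur P 0 \<omega>, sur P 1 \<omega>)"

definition out_vec :: "('w, 'u) process \<Rightarrow> 'w \<Rightarrow> nat \<times> nat \<times> nat \<times> nat" where
  "out_vec P \<omega> = (out P 0 0 \<omega>, out P 0 1 \<omega>, out P 1 0 \<omega>, out P 1 1 \<omega>)"

abbreviation sur_space :: "(nat \<times> nat) measure" where
  "sur_space \<equiv> binary \<Otimes>\<^sub>M binary"

abbreviation out_space :: "(nat \<times> nat \<times> nat \<times> nat) measure" where
  "out_space \<equiv> binary \<Otimes>\<^sub>M (binary \<Otimes>\<^sub>M (binary \<Otimes>\<^sub>M binary))"

definition randomization :: "('w, 'u) process \<Rightarrow> bool" where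
  "randomization P \<longleftrightarrow>
     indep_rv (pr P)
       binary (trt P)
       (out_space \<Otimes>\<^sub>M (sur_space \<Otimes>\<^sub>M cnf_space P)) (\<lambda>\<omega>. (out_vec P \<omega>, sur_vec P \<omega>, cnf P \<omega>))"

text \<open>
  Potential-outcome reading of the causal diagram with edges \<open>T \<rightarrow> S\<close>, \<open>S \<rightarrow> Y\<close>, \<open>U \<rightarrow> S\<close>, \<open>U \<rightarrow> Y\<close> only:
  there is no edge from \<open>T\<close> to \<open>Y\<close> (first conjunct), and \<open>U\<close> carries all confounding between \<open>S\<close> and
  \<open>Y\<close> (second conjunct). That no edge points into \<open>T\<close> is \<^const>\<open>randomization\<close>. The space of \<open>U\<close> and
  its law are unrestricted; in particular \<open>U\<close> may determine all potential outcomes.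
\<close>

definition strong_surrogate :: "('w, 'u) process \<Rightarrow> bool" where
  "strong_surrogate P \<longleftrightarrow>
     (\<forall>s\<in>{0, 1}. \<forall>\<omega>\<in>space (pr P). out P 0 s \<omega> = out P 1 s \<omega>) \<and>
     cond_indep_rv (pr P) sur_space (sur_vec P) out_space (out_vec P) (cnf_space P) (cnf P)"

definition admissible :: "('w, 'u) process \<Rightarrow> bool" where
  "admissible P \<longleftrightarrow> wf_process P \<and> randomization P \<and> strong_surrogate P"

definition obs_sur :: "('w, 'u) process \<Rightarrow> 'w \<Rightarrow> nat" where
  "obs_sur P \<omega> = sur P (trt P \<omega>) \<omega>"

definition obs_out :: "('w, 'u) process \<Rightarrow> 'w \<Rightarrow> nat" where
  "obs_out P \<omega> = out P (trt P \<omega>) (obs_sur P \<omega>) \<omega>"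

definition out_do_trt :: "('w, 'u) process \<Rightarrow> nat \<Rightarrow> 'w \<Rightarrow> nat" where
  "out_do_trt P t \<omega> = out P t (sur P t \<omega>) \<omega>"

text \<open>
  The treatment keeps its natural value here; under \<^const>\<open>strong_surrogate\<close> the first index of \<open>out\<close>
  is immaterial.
\<close>

definition out_do_sur :: "('w, 'u) process \<Rightarrow> nat \<Rightarrow> 'w \<Rightarrow> nat" where
  "out_do_sur P s \<omega> = out P (trt P \<omega>) s \<omega>"

definition ACE_TY :: "('w, 'u) process \<Rightarrow> real" where
  "ACE_TY P = \<P>(\<omega> in pr P. out_do_trt P 1 \<omega> = 1) - \<P>(\<omega> in pr P. out_do_trt P 0 \<omega> = 1)"

definition ACE_SY :: "('w, 'u) process \<Rightarrow> real" where
  "ACE_SY P = \<P>(\<omega> in pr P. out_do_sur P 1 \<omega> = 1) - \<P>(\<omega> in pr P. out_do_sur P 0 \<omega> = 1)"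

text \<open>\<open>p y s = P(Y = y, S = s | T = 0)\<close>, \<open>r s = P(S = s | T = 1)\<close>, and \<open>\<gamma> = ACE(S \<rightarrow> Y)\<close>.\<close>

definition has_observed ::
  "('w, 'u) process \<Rightarrow> (nat \<Rightarrow> nat \<Rightarrow> real) \<Rightarrow> (nat \<Rightarrow> real) \<Rightarrow> real \<Rightarrow> bool" where
  "has_observed P p r \<gamma> \<longleftrightarrow>
     (\<forall>y\<in>{0, 1}. \<forall>s\<in>{0, 1}.
        \<P>(\<omega> in pr P. obs_out P \<omega> = y \<and> obs_sur P \<omega> = s \<bar> trt P \<omega> = 0) = p y s) \<and>
     (\<forall>s\<in>{0, 1}. \<P>(\<omega> in pr P. obs_sur P \<omega> = s \<bar> trt P \<omega> = 1) = r s) \<and>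
     ACE_SY P = \<gamma>"

text \<open>\<open>P(Y = y | T = 0)\<close> as the marginal of \<open>p\<close>.\<close>

definition marg_out :: "(nat \<Rightarrow> nat \<Rightarrow> real) \<Rightarrow> nat \<Rightarrow> real" where
  "marg_out p y = p y 0 + p y 1"

definition lower_bound :: "(nat \<Rightarrow> nat \<Rightarrow> real) \<Rightarrow> (nat \<Rightarrow> real) \<Rightarrow> real \<Rightarrow> real" where
  "lower_bound p r \<gamma> = Max {
     - p 1 0 - r 0,
     - marg_out p 1,
     - p 1 1 - r 1,
     - \<gamma> - r 1 - p 1 0,
     - \<gamma> - p 0 1 - 2 * p 1 0,
     \<gamma> - 2 * p 1 1 - p 0 0,
     \<gamma> - r 0 - p 1 1}"

definition upper_bound :: "(nat \<Rightarrow> nat \<Rightarrow> real) \<Rightarrow> (nat \<Rightarrow> real) \<Rightarrow> real \<Rightarrow> real" where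
  "upper_bound p r \<gamma> = Min {
     p 0 0 + r 0,
     marg_out p 0,
     p 0 1 + r 1,
     \<gamma> + p 1 0 + 2 * p 0 1,
     \<gamma> + p 0 1 + r 0,
     - \<gamma> + 2 * p 0 0 + p 1 1,
     - \<gamma> + p 0 0 + r 1}"

end

theory Submission
  imports Defs
begin

text \<open>
  All observed quantities and the target are linear in the joint law \<open>q\<close> of \<open>(Y\<^sub>0, Y\<^sub>1, S\<^sub>0, S\<^sub>1)\<close>, and
  every \<open>q\<close> comes from a process, since \<open>U\<close> may be taken to be the vector itself. So the sharp bounds
  are the two values of a linear program with 16 variables. Exchanging \<open>Y\<close> and \<open>1 - Y\<close> turns the
  minimum into a maximum. For the maximum, the program splits into the two arms \<open>S\<^sub>0 = 0\<close> and
  \<open>S\<^sub>0 = 1\<close>. In each arm only two numbers matter: the mass \<open>A\<close> of the units with counterfactual outcome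
  \<open>1\<close>, and the mass \<open>W\<close> of the units with \<open>S\<^sub>1 \<noteq> S\<^sub>0\<close>. The value of \<open>\<gamma>\<close> fixes the difference of the
  two \<open>A\<close>'s, and \<open>r\<close> fixes the difference of the two \<open>W\<close>'s. The optimal gain of an arm is a
  nondecreasing function of \<open>A\<close>, so \<open>A\<close> is made as large as possible and only \<open>W\<close> remains to be chosen.
\<close>

section \<open>The linear program for the joint law\<close>

text \<open>\<open>q a b c d\<close> is the weight of \<open>Y\<^sub>0 = a\<close>, \<open>Y\<^sub>1 = b\<close>, \<open>S\<^sub>0 = c\<close>, \<open>S\<^sub>1 = d\<close>; values outside \<open>{0, 1}\<close> are ignored.\<close>

definition mass ::
  "(nat \<Rightarrow> nat \<Rightarrow> nat \<Rightarrow> nat \<Rightarrow> real) \<Rightarrow> (nat \<Rightarrow> nat \<Rightarrow> nat \<Rightarrow> nat \<Rightarrow> bool) \<Rightarrow> real" where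
  "mass q \<phi> = (\<Sum>a\<in>{0, 1}. \<Sum>b\<in>{0, 1}. \<Sum>c\<in>{0, 1}. \<Sum>d\<in>{0, 1}. if \<phi> a b c d then q a b c d else 0)"

text \<open>The last argument \<open>\<delta>\<close> is the value of \<open>ACE(T \<rightarrow> Y)\<close>.\<close>

definition consistent ::
  "(nat \<Rightarrow> nat \<Rightarrow> nat \<Rightarrow> nat \<Rightarrow> real) \<Rightarrow> (nat \<Rightarrow> nat \<Rightarrow> real) \<Rightarrow> (nat \<Rightarrow> real) \<Rightarrow> real \<Rightarrow> real \<Rightarrow> bool" where
  "consistent q p r \<gamma> \<delta> \<longleftrightarrow>
     (\<forall>a\<in>{0, 1}. \<forall>b\<in>{0, 1}. \<forall>c\<in>{0, 1}. \<forall>d\<in>{0, 1}. 0 \<le> q a b c d) \<and>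
     mass q (\<lambda>_ _ _ _. True) = 1 \<and>
     (\<forall>y\<in>{0, 1}. \<forall>s\<in>{0, 1}. mass q (\<lambda>a b c d. (if c = 0 then a else b) = y \<and> c = s) = p y s) \<and>
     (\<forall>s\<in>{0, 1}. mass q (\<lambda>a b c d. d = s) = r s) \<and>
     mass q (\<lambda>a b c d. b = 1) - mass q (\<lambda>a b c d. a = 1) = \<gamma> \<and>
     mass q (\<lambda>a b c d. (if d = 0 then a else b) = 1) -
       mass q (\<lambda>a b c d. (if c = 0 then a else b) = 1) = \<delta>"

text \<open>Units with Y_0 = Y_1 cancel in \<gamma>; in \<delta> so do units with S_0 = S_1, which
  leaves four weights.\<close>

lemma consistent_iff:
  "consistent q p r \<gamma> \<delta> \<longleftrightarrow>
     (\<forall>a\<in>{0, 1}. \<forall>b\<in>{0, 1}. \<forall>c\<in>{0, 1}. \<forall>d\<in>{0, 1}. 0 \<le> q a b c d) \<and>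
     q 0 0 0 0 + q 0 0 0 1 + q 0 0 1 0 + q 0 0 1 1 + q 0 1 0 0 + q 0 1 0 1 + q 0 1 1 0 + q 0 1 1 1 +
       q 1 0 0 0 + q 1 0 0 1 + q 1 0 1 0 + q 1 0 1 1 + q 1 1 0 0 + q 1 1 0 1 + q 1 1 1 0 + q 1 1 1 1 = 1 \<and>
     q 0 0 0 0 + q 0 0 0 1 + q 0 1 0 0 + q 0 1 0 1 = p 0 0 \<and>
     q 0 0 1 0 + q 0 0 1 1 + q 1 0 1 0 + q 1 0 1 1 = p 0 1 \<and>
     q 1 0 0 0 + q 1 0 0 1 + q 1 1 0 0 + q 1 1 0 1 = p 1 0 \<and>
     q 0 1 1 0 + q 0 1 1 1 + q 1 1 1 0 + q 1 1 1 1 = p 1 1 \<and>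
     q 0 0 0 0 + q 0 0 1 0 + q 0 1 0 0 + q 0 1 1 0 +
       q 1 0 0 0 + q 1 0 1 0 + q 1 1 0 0 + q 1 1 1 0 = r 0 \<and>
     q 0 0 0 1 + q 0 0 1 1 + q 0 1 0 1 + q 0 1 1 1 +
       q 1 0 0 1 + q 1 0 1 1 + q 1 1 0 1 + q 1 1 1 1 = r 1 \<and>
     (q 0 1 0 0 + q 0 1 0 1 + q 0 1 1 0 + q 0 1 1 1) -
       (q 1 0 0 0 + q 1 0 0 1 + q 1 0 1 0 + q 1 0 1 1) = \<gamma> \<and>
     (q 0 1 0 1 + q 1 0 1 0) - (q 0 1 1 0 + q 1 0 0 1) = \<delta>"
  by (simp add: consistent_def mass_def algebra_simps)

text \<open>Weak duality: written in the sixteen weights, each of the seven terms minus \<delta> has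
  only nonnegative coefficients.\<close>

lemma consistent_le_upper_bound:
  assumes "consistent q p r \<gamma> \<delta>"
  shows "\<delta> \<le> upper_bound p r \<gamma>"
proof -
  have nonneg: "0 \<le> q a b c d" if "a \<in> {0, 1}" "b \<in> {0, 1}" "c \<in> {0, 1}" "d \<in> {0, 1}" for a b c d
    using assms that unfolding consistent_def by blast
  have "\<forall>u\<in>{p 0 0 + r 0, p 0 0 + p 0 1, p 0 1 + r 1, \<gamma> + p 1 0 + 2 * p 0 1,
      \<gamma> + p 0 1 + r 0, - \<gamma> + 2 * p 0 0 + p 1 1, - \<gamma> + p 0 0 + r 1}. \<delta> \<le> u"
    using assms unfolding consistent_iff
    by (elim conjE; hypsubst) (auto intro!: add_nonneg_nonneg nonneg simp: algebra_simps)
  then show ?thesis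
    unfolding upper_bound_def marg_out_def
    by (subst Min_ge_iff) (simp_all only: finite.intros insert_not_empty not_False_eq_True)
qed

text \<open>Units with (Y_0, Y_1) = (1, 0) are counted in \<open>p 1 0\<close> or
  \<open>p 0 1\<close>, those with (0, 1) in \<open>p 0 0\<close> or \<open>p 1 1\<close>; hence the
  range of \<gamma>.\<close>

lemma consistent_observed:
  assumes "consistent q p r \<gamma> \<delta>"
  shows "0 \<le> p 0 0" "0 \<le> p 0 1" "0 \<le> p 1 0" "0 \<le> p 1 1" "0 \<le> r 0" "0 \<le> r 1"
    and "p 0 0 + p 0 1 + p 1 0 + p 1 1 = 1" "r 0 + r 1 = 1"
    and "- p 1 0 - p 0 1 \<le> \<gamma>" "\<gamma> \<le> p 0 0 + p 1 1"
  using assms by (simp_all add: consistent_def mass_def)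

lemma consistent_flip:
  assumes "consistent q p r \<gamma> \<delta>"
  shows "consistent (\<lambda>a b. q (1 - a) (1 - b)) (\<lambda>y. p (1 - y)) r (- \<gamma>) (- \<delta>)"
  using assms by (simp add: consistent_def mass_def)

lemma lower_bound_flip: "lower_bound p r \<gamma> = - upper_bound (\<lambda>y. p (1 - y)) r (- \<gamma>)"
  unfolding lower_bound_def upper_bound_def marg_out_def
  by (subst minus_Min_eq_Max, simp, simp, rule arg_cong[of _ _ Max]) auto

section \<open>Solving the linear program\<close>

text \<open>
  In an arm \<open>S\<^sub>0 = s\<close>, whose units with \<open>Y\<^sub>s = y\<close> have mass \<open>p\<^sub>y\<close>, let \<open>m y z t\<close> be the mass with
  \<open>Y\<^sub>s = y\<close>, \<open>Y\<^bsub>1-s\<^esub> = z\<close>, and \<open>t = 1\<close> iff \<open>S\<^sub>1 \<noteq> S\<^sub>0\<close>. The arm contributes \<open>m 0 1 1 - m 1 0 1\<close> to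
  \<open>ACE(T \<rightarrow> Y)\<close>, and \<open>arm_gain p\<^sub>0 A W\<close> is the largest such contribution.
\<close>

definition arm_gain :: "real \<Rightarrow> real \<Rightarrow> real \<Rightarrow> real" where
  "arm_gain p0 A W = min (min A W) (min p0 (A + p0 - W))"

text \<open>Both \<open>A\<close> and \<open>W\<close> are placed in the stratum of factual outcome
  0 first. Within each stratum the two events are then nested, which for these marginals makes
  \<open>m 0 1 1\<close> largest and \<open>m 1 0 1\<close> smallest.\<close>

lemma arm_gain_attained:
  fixes p0 p1 A W :: real
  assumes "0 \<le> p0" "0 \<le> p1" "0 \<le> A" "A \<le> p0 + p1" "0 \<le> W" "W \<le> p0 + p1"
  obtains m :: "nat \<Rightarrow> nat \<Rightarrow> nat \<Rightarrow> real" where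
    "\<And>y z t. 0 \<le> m y z t"
    "m 0 0 0 + m 0 0 1 + m 0 1 0 + m 0 1 1 = p0"
    "m 1 0 0 + m 1 0 1 + m 1 1 0 + m 1 1 1 = p1"
    "m 0 1 0 + m 0 1 1 + m 1 1 0 + m 1 1 1 = A"
    "m 0 0 1 + m 0 1 1 + m 1 0 1 + m 1 1 1 = W"
    "arm_gain p0 A W \<le> m 0 1 1 - m 1 0 1"
proof -
  \<comment> \<open>In the stratum of factual outcome \<open>y\<close>, of mass \<open>P y\<close>,
    \<open>x y\<close> is the mass with counterfactual outcome 1 and \<open>w y\<close> that with
    S_1 \<noteq> S_0. Arguments other than 0 count as 1, so \<open>m\<close> is nonnegative
    everywhere.\<close>
  define x where "x y = (if y = 0 then min p0 A else A - min p0 A)" for y :: nat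
  define w where "w y = (if y = 0 then min p0 W else W - min p0 W)" for y :: nat
  define P where "P y = (if y = 0 then p0 else p1)" for y :: nat
  define m where "m y z t =
     (if z = 0 then if t = 0 then P y - max (x y) (w y) else w y - min (x y) (w y)
      else if t = 0 then x y - min (x y) (w y) else min (x y) (w y))" for y z t :: nat
  show thesis
    by (rule that[of m])
       (use assms in \<open>auto simp: m_def x_def w_def P_def arm_gain_def min_def max_def\<close>)
qed

text \<open>
  The arms \<open>S\<^sub>0 = 0\<close> and \<open>S\<^sub>0 = 1\<close> have total masses \<open>h\<close> and \<open>g\<close> and parameters \<open>(A, W)\<close> and
  \<open>(A - c, W + e)\<close>. The case \<open>h \<le> g + c\<close> is the one where the largest possible \<open>A\<close> is \<open>h\<close>;
  the other case follows by exchanging the arms.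
\<close>

lemma balanced_arms_saturated:
  fixes p0 p1 n0 n1 c e V :: real
  defines "h \<equiv> p0 + p1" and "g \<equiv> n0 + n1"
  assumes "0 \<le> p0" "0 \<le> p1" "0 \<le> n0" "0 \<le> n1"
    and "c \<le> h" "- g \<le> c" "- e \<le> h" "e \<le> g"
    and "V \<le> p0 + h + e" "V \<le> n0 + g - e" "V \<le> p0 + n0"
    and "V \<le> g + c + n0" "V \<le> g + c + p0 + e" "V \<le> h - c + p0" "V \<le> h - c + n0 - e"
    and "h \<le> g + c"
  obtains W where "0 \<le> W" "W \<le> h" "- e \<le> W" "W \<le> g - e"
    and "V \<le> arm_gain p0 h W + arm_gain n0 (h - c) (W + e)"
proof -
  \<comment> \<open>The first gain stops growing at \<open>W = p0\<close> and stays constant up to \<open>W = h\<close>; the second one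
    stops growing at \<open>W + e = min (h - c) n0\<close>.\<close>
  define W where "W = min (g - e) (max p0 (min h (min (h - c) n0 - e)))"
  have "0 \<le> W" "W \<le> h" "- e \<le> W" "W \<le> g - e"
    using assms unfolding W_def by linarith+
  moreover have "V \<le> arm_gain p0 h W + arm_gain n0 (h - c) (W + e)"
  proof -
    \<comment> \<open>One case per candidate for \<open>W\<close>, with side conditions locating the
      breakpoints of the two gains; the rest is linear.\<close>
    have "W = g - e \<and> g - e \<le> p0 \<or>
       W = p0 \<and> (h = p0 \<or> min (h - c) n0 \<le> p0 + e) \<or>
       W = h \<and> h \<le> min (h - c) n0 - e \<or>
       W = min (h - c) n0 - e \<and> p0 \<le> W"
      using assms unfolding W_def by linarith
    then show ?thesis
      using assms(3-) unfolding arm_gain_def h_def g_def by linarith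
  qed
  ultimately show thesis by (rule that)
qed

text \<open>The conditions on \<open>c\<close> and \<open>e\<close> make the ranges of
  \<open>A\<close> and \<open>W\<close> nonempty; the seven bounds on \<open>V\<close> will be the
  terms of \<open>upper_bound\<close>.\<close>

lemma balanced_arms:
  fixes p0 p1 n0 n1 c e V :: real
  defines "h \<equiv> p0 + p1" and "g \<equiv> n0 + n1"
  assumes nonneg: "0 \<le> p0" "0 \<le> p1" "0 \<le> n0" "0 \<le> n1"
    and range: "c \<le> h" "- g \<le> c" "- e \<le> h" "e \<le> g"
    and V: "V \<le> p0 + h + e" "V \<le> n0 + g - e" "V \<le> p0 + n0"
      "V \<le> g + c + n0" "V \<le> g + c + p0 + e" "V \<le> h - c + p0" "V \<le> h - c + n0 - e"
  obtains A W where "0 \<le> A" "A \<le> h" "c \<le> A" "A \<le> g + c"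
    and "0 \<le> W" "W \<le> h" "- e \<le> W" "W \<le> g - e"
    and "V \<le> arm_gain p0 A W + arm_gain n0 (A - c) (W + e)"
proof (cases "h \<le> g + c")
  case True
  show thesis
  proof (rule balanced_arms_saturated[of p0 p1 n0 n1 c e V])
    show "p0 + p1 \<le> n0 + n1 + c"
      using True by (simp add: h_def g_def)
  next
    fix W
    assume "0 \<le> W" "W \<le> p0 + p1" "- e \<le> W" "W \<le> n0 + n1 - e"
      "V \<le> arm_gain p0 (p0 + p1) W + arm_gain n0 (p0 + p1 - c) (W + e)"
    with True nonneg range show thesis
      by (intro that[of h W]) (simp_all add: h_def g_def)
  qed (use nonneg range V in \<open>simp_all add: h_def g_def\<close>)
next
  case False
  show thesis
  proof (rule balanced_arms_saturated[of n0 n1 p0 p1 "- c" "- e" V])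
    show "n0 + n1 \<le> p0 + p1 + - c"
      using False by (simp add: h_def g_def)
  next
    fix W
    assume "0 \<le> W" "W \<le> n0 + n1" "- (- e) \<le> W" "W \<le> p0 + p1 - - e"
      "V \<le> arm_gain n0 (n0 + n1) W + arm_gain p0 (n0 + n1 - - c) (W + - e)"
    \<comment> \<open>Now the arm S_0 = 1 is saturated, so \<open>A - c = g\<close>; the new
      \<open>W\<close> belongs to that arm, so the other one gets \<open>W - e\<close>.\<close>
    with False nonneg range show thesis
      by (intro that[of "g + c" "W - e"]) (simp_all add: h_def g_def)
  qed (use nonneg range V in \<open>simp_all add: h_def g_def\<close>)
qed

lemma upper_bound_attained:
  assumes "consistent q0 p r \<gamma> \<delta>"
  shows "\<exists>q. consistent q p r \<gamma> (upper_bound p r \<gamma>)"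
proof -
  note obs = consistent_observed[OF assms]
  define V where "V = upper_bound p r \<gamma>"
  \<comment> \<open>P(Y_1 = 1) is \<open>A + p 1 1\<close> and P(Y_0 = 1) is \<open>p 1 0\<close>
    plus the second arm's \<open>A\<close>, which gives \<open>c\<close>. S_1 = 0 holds for the
    first arm's non-switchers and the second arm's switchers, which gives \<open>e\<close>.\<close>
  define c where "c = \<gamma> + p 1 0 - p 1 1"
  define e where "e = r 0 - p 0 0 - p 1 0"
  have V: "V \<le> p 0 0 + r 0" "V \<le> p 0 0 + p 0 1" "V \<le> p 0 1 + r 1" "V \<le> \<gamma> + p 1 0 + 2 * p 0 1"
    "V \<le> \<gamma> + p 0 1 + r 0" "V \<le> - \<gamma> + 2 * p 0 0 + p 1 1" "V \<le> - \<gamma> + p 0 0 + r 1"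
    unfolding V_def upper_bound_def marg_out_def by (rule Min_le; simp)+
  obtain A W where
    A: "0 \<le> A" "A \<le> p 0 0 + p 1 0" "c \<le> A" "A \<le> p 0 1 + p 1 1 + c" and
    W: "0 \<le> W" "W \<le> p 0 0 + p 1 0" "- e \<le> W" "W \<le> p 0 1 + p 1 1 - e" and
    gain: "V \<le> arm_gain (p 0 0) A W + arm_gain (p 0 1) (A - c) (W + e)"
  proof (rule balanced_arms[of "p 0 0" "p 1 0" "p 0 1" "p 1 1" c e V])
    show "V \<le> p 0 0 + (p 0 0 + p 1 0) + e" "V \<le> p 0 1 + (p 0 1 + p 1 1) - e"
      "V \<le> p 0 0 + p 0 1" "V \<le> p 0 1 + p 1 1 + c + p 0 1" "V \<le> p 0 1 + p 1 1 + c + p 0 0 + e"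
      "V \<le> p 0 0 + p 1 0 - c + p 0 0" "V \<le> p 0 0 + p 1 0 - c + p 0 1 - e"
      using V obs(7,8) unfolding c_def e_def by linarith+
  qed (use obs in \<open>simp_all add: c_def e_def\<close>)
  obtain m :: "nat \<Rightarrow> nat \<Rightarrow> nat \<Rightarrow> real" where m: "\<And>y z t. 0 \<le> m y z t"
    "m 0 0 0 + m 0 0 1 + m 0 1 0 + m 0 1 1 = p 0 0"
    "m 1 0 0 + m 1 0 1 + m 1 1 0 + m 1 1 1 = p 1 0"
    "m 0 1 0 + m 0 1 1 + m 1 1 0 + m 1 1 1 = A"
    "m 0 0 1 + m 0 1 1 + m 1 0 1 + m 1 1 1 = W"
    "arm_gain (p 0 0) A W \<le> m 0 1 1 - m 1 0 1"
    by (rule arm_gain_attained[OF obs(1,3) A(1,2) W(1,2)]) (rule that)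
  have AW: "0 \<le> A - c" "A - c \<le> p 0 1 + p 1 1" "0 \<le> W + e" "W + e \<le> p 0 1 + p 1 1"
    using A W by simp_all
  obtain n :: "nat \<Rightarrow> nat \<Rightarrow> nat \<Rightarrow> real" where n: "\<And>y z t. 0 \<le> n y z t"
    "n 0 0 0 + n 0 0 1 + n 0 1 0 + n 0 1 1 = p 0 1"
    "n 1 0 0 + n 1 0 1 + n 1 1 0 + n 1 1 1 = p 1 1"
    "n 0 1 0 + n 0 1 1 + n 1 1 0 + n 1 1 1 = A - c"
    "n 0 0 1 + n 0 1 1 + n 1 0 1 + n 1 1 1 = W + e"
    "arm_gain (p 0 1) (A - c) (W + e) \<le> n 0 1 1 - n 1 0 1"
    by (rule arm_gain_attained[OF obs(2,4) AW]) (rule that)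
  \<comment> \<open>In the arm S_0 = 1 the factual outcome is Y_1 and switching means S_1 = 0, hence
    the swapped arguments and \<open>1 - t\<close>.\<close>
  define q where "q a b s t = (if s = 0 then m a b t else n b a (1 - t))" for a b s t :: nat
  have *: "consistent q p r \<gamma> (m 0 1 1 - m 1 0 1 + n 0 1 1 - n 1 0 1)"
    unfolding consistent_iff
    by (intro conjI)
       (use m(1) n(1) in \<open>simp add: q_def\<close>,
        (use m(2-5) n(2-5) obs(7,8) in \<open>simp only: q_def c_def e_def simp_thms if_True if_False
           zero_neq_one one_neq_zero diff_self_eq_0 diff_zero; linarith\<close>)+)
  \<comment> \<open>The gains give only \<ge>; weak duality gives \<le>.\<close>
  moreover have "m 0 1 1 - m 1 0 1 + n 0 1 1 - n 1 0 1 = V"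
    using consistent_le_upper_bound[OF *] m(6) n(6) gain by (simp add: V_def)
  ultimately show ?thesis by (auto simp: V_def)
qed

section \<open>The joint law of an admissible process\<close>

lemma count_space_event_sets:
  assumes "V \<in> N \<rightarrow>\<^sub>M count_space I"
  shows "{\<omega> \<in> space N. \<phi> (V \<omega>)} \<in> sets N"
proof -
  have "V -` {v \<in> I. \<phi> v} \<inter> space N \<in> sets N"
    using assms by (rule measurable_sets) simp
  moreover have "V -` {v \<in> I. \<phi> v} \<inter> space N = {\<omega> \<in> space N. \<phi> (V \<omega>)}"
    using measurable_space[OF assms] by auto
  ultimately show ?thesis by simp
qed

lemma (in finite_measure) measure_event_eq_sum:
  assumes V: "V \<in> M \<rightarrow>\<^sub>M count_space I" and I: "finite I"
  shows "measure M {\<omega> \<in> space M. \<phi> (V \<omega>)} =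
    (\<Sum>v\<in>I. if \<phi> v then measure M {\<omega> \<in> space M. V \<omega> = v} else 0)"
proof -
  have "{\<omega> \<in> space M. \<phi> (V \<omega>)} = (\<Union>v \<in> {v \<in> I. \<phi> v}. {\<omega> \<in> space M. V \<omega> = v})"
    using measurable_space[OF V] by auto
  also have "measure M \<dots> = (\<Sum>v \<in> {v \<in> I. \<phi> v}. measure M {\<omega> \<in> space M. V \<omega> = v})"
    using I count_space_event_sets[OF V, of "\<lambda>x. x = v" for v]
    by (intro finite_measure_finite_Union) (auto simp: disjoint_family_on_def)
  also have "\<dots> = (\<Sum>v\<in>I. if \<phi> v then measure M {\<omega> \<in> space M. V \<omega> = v} else 0)"
    using I by (rule sum.inter_filter)
  finally show ?thesis .
qed

lemma measurable_binary_quadruple: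
  assumes "A \<in> N \<rightarrow>\<^sub>M binary" "B \<in> N \<rightarrow>\<^sub>M binary" "C \<in> N \<rightarrow>\<^sub>M binary" "D \<in> N \<rightarrow>\<^sub>M binary"
  shows "(\<lambda>\<omega>. (A \<omega>, B \<omega>, C \<omega>, D \<omega>)) \<in> N \<rightarrow>\<^sub>M count_space ({0, 1} \<times> {0, 1} \<times> {0, 1} \<times> {0, 1})"
proof -
  have "(\<lambda>\<omega>. (A \<omega>, B \<omega>, C \<omega>, D \<omega>)) \<in> N \<rightarrow>\<^sub>M out_space"
    by (intro measurable_Pair assms)
  then show ?thesis
    by (simp only: pair_measure_count_space finite.intros finite_SigmaI)
qed

lemma binary_event_sets:
  assumes "A \<in> N \<rightarrow>\<^sub>M binary" "B \<in> N \<rightarrow>\<^sub>M binary" "C \<in> N \<rightarrow>\<^sub>M binary" "D \<in> N \<rightarrow>\<^sub>M binary"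
  shows "{\<omega> \<in> space N. \<phi> (A \<omega>) (B \<omega>) (C \<omega>) (D \<omega>)} \<in> sets N"
  using count_space_event_sets[OF measurable_binary_quadruple[OF assms], of "\<lambda>(a, b, c, d). \<phi> a b c d"]
  by (simp only: prod.case)

lemma (in finite_measure) measure_binary_event:
  assumes "A \<in> M \<rightarrow>\<^sub>M binary" "B \<in> M \<rightarrow>\<^sub>M binary" "C \<in> M \<rightarrow>\<^sub>M binary" "D \<in> M \<rightarrow>\<^sub>M binary"
  shows "measure M {\<omega> \<in> space M. \<phi> (A \<omega>) (B \<omega>) (C \<omega>) (D \<omega>)} =
    mass (\<lambda>a b c d. measure M {\<omega> \<in> space M. A \<omega> = a \<and> B \<omega> = b \<and> C \<omega> = c \<and> D \<omega> = d}) \<phi>"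
proof -
  have "measure M {\<omega> \<in> space M. case (A \<omega>, B \<omega>, C \<omega>, D \<omega>) of (a, b, c, d) \<Rightarrow> \<phi> a b c d} =
      (\<Sum>v \<in> {0, 1} \<times> {0, 1} \<times> {0, 1} \<times> {0, 1}. if case v of (a, b, c, d) \<Rightarrow> \<phi> a b c d
         then measure M {\<omega> \<in> space M. (A \<omega>, B \<omega>, C \<omega>, D \<omega>) = v} else 0)"
    by (rule measure_event_eq_sum[OF measurable_binary_quadruple[OF assms]])
       (intro finite_SigmaI finite.intros)
  also have "\<dots> = (\<Sum>(a, b, c, d) \<in> {0, 1} \<times> {0, 1} \<times> {0, 1} \<times> {0, 1}. if \<phi> a b c d
         then measure M {\<omega> \<in> space M. A \<omega> = a \<and> B \<omega> = b \<and> C \<omega> = c \<and> D \<omega> = d} else 0)"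
    by (rule sum.cong[OF refl]) (simp only: split_paired_all prod.case prod.inject)
  finally show ?thesis
    by (simp only: mass_def sum.cartesian_product prod.case)
qed

text \<open>Outcomes are read at treatment 0, which stands for both treatments since T has no direct
  effect on Y.\<close>

definition joint_law :: "('w, 'u) process \<Rightarrow> nat \<Rightarrow> nat \<Rightarrow> nat \<Rightarrow> nat \<Rightarrow> real" where
  "joint_law P a b c d =
     \<P>(\<omega> in pr P. out P 0 0 \<omega> = a \<and> out P 0 1 \<omega> = b \<and> sur P 0 \<omega> = c \<and> sur P 1 \<omega> = d)"

abbreviation potential_event ::
  "('w, 'u) process \<Rightarrow> (nat \<Rightarrow> nat \<Rightarrow> nat \<Rightarrow> nat \<Rightarrow> bool) \<Rightarrow> 'w set" where
  "potential_event P \<phi> \<equiv>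
     {\<omega> \<in> space (pr P). \<phi> (out P 0 0 \<omega>) (out P 0 1 \<omega>) (sur P 0 \<omega>) (sur P 1 \<omega>)}"

lemma prob_potential_event:
  assumes "wf_process P"
  shows "measure (pr P) (potential_event P \<phi>) = mass (joint_law P) \<phi>"
proof -
  interpret prob_space "pr P" using assms by (simp add: wf_process_def)
  have "measure (pr P) (potential_event P \<phi>) = mass (\<lambda>a b c d. joint_law P a b c d) \<phi>"
    unfolding joint_law_def by (rule measure_binary_event) (use assms in \<open>simp_all add: wf_process_def\<close>)
  then show ?thesis by simp
qed

lemma measurable_potentials:
  assumes "wf_process P"
  shows "(\<lambda>\<omega>. (out_vec P \<omega>, sur_vec P \<omega>, cnf P \<omega>)) \<in>
    pr P \<rightarrow>\<^sub>M out_space \<Otimes>\<^sub>M (sur_space \<Otimes>\<^sub>M cnf_space P)"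
  using assms unfolding wf_process_def out_vec_def sur_vec_def by (intro measurable_Pair) auto

text \<open>On \<open>trt P \<omega> = t\<close> the event is one about the potential variables
  alone, and randomization removes the conditioning.\<close>

lemma cond_prob_potential_event:
  assumes wf: "wf_process P" and rand: "randomization P" and t: "t \<in> {0, 1}"
    and E: "\<And>\<omega>. \<omega> \<in> space (pr P) \<Longrightarrow> trt P \<omega> = t \<Longrightarrow>
      E \<omega> \<longleftrightarrow> \<phi> (out P 0 0 \<omega>) (out P 0 1 \<omega>) (sur P 0 \<omega>) (sur P 1 \<omega>)"
  shows "\<P>(\<omega> in pr P. E \<omega> \<bar> trt P \<omega> = t) = mass (joint_law P) \<phi>"
proof -
  interpret prob_space "pr P" using wf by (simp add: wf_process_def)
  have trt: "trt P \<in> pr P \<rightarrow>\<^sub>M binary" using wf by (simp add: wf_process_def)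
  let ?Z = "\<lambda>\<omega>. (out_vec P \<omega>, sur_vec P \<omega>, cnf P \<omega>)"
  let ?C = "out_space \<Otimes>\<^sub>M (sur_space \<Otimes>\<^sub>M cnf_space P)"
  let ?N = "vimage_algebra (space (pr P)) ?Z ?C"
  let ?T = "{\<omega> \<in> space (pr P). trt P \<omega> = t}"
  have "?Z \<in> space (pr P) \<rightarrow> space ?C"
    by (intro Pi_I) (rule measurable_space[OF measurable_potentials[OF wf]])
  then have Z: "?Z \<in> ?N \<rightarrow>\<^sub>M ?C"
    by (rule measurable_vimage_algebra1)
  have proj: "(\<lambda>\<omega>. f (?Z \<omega>)) \<in> ?N \<rightarrow>\<^sub>M binary" if "f \<in> ?C \<rightarrow>\<^sub>M binary" for f
    using measurable_compose[OF Z that] .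
  have "(\<lambda>z. fst (fst z)) \<in> ?C \<rightarrow>\<^sub>M binary" "(\<lambda>z. fst (snd (fst z))) \<in> ?C \<rightarrow>\<^sub>M binary"
    "(\<lambda>z. fst (fst (snd z))) \<in> ?C \<rightarrow>\<^sub>M binary" "(\<lambda>z. snd (fst (snd z))) \<in> ?C \<rightarrow>\<^sub>M binary"
    by measurable
  from this[THEN proj] have "{\<omega> \<in> space ?N. \<phi> (out P 0 0 \<omega>) (out P 0 1 \<omega>) (sur P 0 \<omega>) (sur P 1 \<omega>)} \<in> sets ?N"
    unfolding out_vec_def sur_vec_def fst_conv snd_conv by (rule binary_event_sets)
  then have phi: "potential_event P \<phi> \<in> sets ?N"
    by simp
  have T: "?T \<in> sets (vimage_algebra (space (pr P)) (trt P) binary)"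
  proof -
    have "trt P -` {t} \<inter> space (pr P) \<in> sets (vimage_algebra (space (pr P)) (trt P) binary)"
      by (rule in_vimage_algebra) (use t in auto)
    moreover have "trt P -` {t} \<inter> space (pr P) = ?T"
      by auto
    ultimately show ?thesis by simp
  qed
  have "prob (?T \<inter> potential_event P \<phi>) = prob ?T * prob (potential_event P \<phi>)"
    using rand T phi unfolding randomization_def indep_rv_def indep_sets2_eq by blast
  moreover have "{\<omega> \<in> space (pr P). E \<omega> \<and> trt P \<omega> = t} = ?T \<inter> potential_event P \<phi>"
    using E by auto
  moreover have "prob ?T \<noteq> 0"
  proof (cases "t = 1")
    case True
    then show ?thesis using wf by (simp add: wf_process_def)
  next
    case False
    have "prob {\<omega> \<in> space (pr P). \<not> trt P \<omega> = 1} = 1 - prob {\<omega> \<in> space (pr P). trt P \<omega> = 1}"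
      by (rule prob_neg) (rule count_space_event_sets[OF trt])
    moreover have "{\<omega> \<in> space (pr P). \<not> trt P \<omega> = 1} = ?T"
      using measurable_space[OF trt] t False by auto
    ultimately show ?thesis using wf by (simp add: wf_process_def)
  qed
  ultimately show ?thesis
    using prob_potential_event[OF wf] by (simp add: cond_prob_def)
qed

lemma consistent_joint_law_iff:
  assumes "admissible P"
  shows "consistent (joint_law P) p r \<gamma> \<delta> \<longleftrightarrow> has_observed P p r \<gamma> \<and> ACE_TY P = \<delta>"
proof -
  have wf: "wf_process P" and rand: "randomization P"
    and out: "\<And>s \<omega>. s \<in> {0, 1} \<Longrightarrow> \<omega> \<in> space (pr P) \<Longrightarrow> out P 1 s \<omega> = out P 0 s \<omega>"
    using assms by (auto simp: admissible_def strong_surrogate_def)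
  interpret prob_space "pr P" using wf by (simp add: wf_process_def)
  have bin: "trt P \<omega> \<in> {0, 1}" "sur P 0 \<omega> \<in> {0, 1}" "sur P 1 \<omega> \<in> {0, 1}"
    if "\<omega> \<in> space (pr P)" for \<omega>
    using wf that measurable_space[of "trt P" "pr P" binary \<omega>]
      measurable_space[of "sur P 0" "pr P" binary \<omega>]
      measurable_space[of "sur P 1" "pr P" binary \<omega>] by (simp_all add: wf_process_def)
  have out_sur: "out P 0 (sur P t \<omega>) \<omega> = (if sur P t \<omega> = 0 then out P 0 0 \<omega> else out P 0 1 \<omega>)"
    if "\<omega> \<in> space (pr P)" "t \<in> {0, 1}" for t \<omega>
    using bin(2,3)[OF that(1)] that(2) by auto
  have sum: "mass (joint_law P) (\<lambda>_ _ _ _. True) = 1"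
    using prob_potential_event[OF wf, of "\<lambda>_ _ _ _. True"] prob_space by simp
  have p: "\<P>(\<omega> in pr P. obs_out P \<omega> = y \<and> obs_sur P \<omega> = s \<bar> trt P \<omega> = 0) =
      mass (joint_law P) (\<lambda>a b c d. (if c = 0 then a else b) = y \<and> c = s)" for y s
    by (rule cond_prob_potential_event[OF wf rand]) (simp_all add: obs_out_def obs_sur_def out_sur)
  have r: "\<P>(\<omega> in pr P. obs_sur P \<omega> = s \<bar> trt P \<omega> = 1) = mass (joint_law P) (\<lambda>a b c d. d = s)" for s
    by (rule cond_prob_potential_event[OF wf rand]) (auto simp: obs_sur_def)
  have out_t: "out P t s \<omega> = out P 0 s \<omega>" if "\<omega> \<in> space (pr P)" "s \<in> {0, 1}" "t \<in> {0, 1}" for t s \<omega>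
    using out that by auto
  have do_s: "out_do_sur P s \<omega> = out P 0 s \<omega>" if "\<omega> \<in> space (pr P)" "s \<in> {0, 1}" for s \<omega>
    unfolding out_do_sur_def by (rule out_t[OF that bin(1)[OF that(1)]])
  have do_sur: "\<P>(\<omega> in pr P. out_do_sur P 0 \<omega> = 1) = mass (joint_law P) (\<lambda>a b c d. a = 1)"
    "\<P>(\<omega> in pr P. out_do_sur P 1 \<omega> = 1) = mass (joint_law P) (\<lambda>a b c d. b = 1)"
    unfolding prob_potential_event[OF wf, symmetric]
    by (rule arg_cong[of _ _ prob], rule Collect_cong, rule conj_cong[OF refl],
        simp only: do_s insert_iff simp_thms)+
  have do_t: "out_do_trt P t \<omega> = (if sur P t \<omega> = 0 then out P 0 0 \<omega> else out P 0 1 \<omega>)"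
    if "\<omega> \<in> space (pr P)" "t \<in> {0, 1}" for t \<omega>
  proof -
    have "sur P t \<omega> \<in> {0, 1}" using bin(2,3)[OF that(1)] that(2) by auto
    from out_t[OF that(1) this that(2)] show ?thesis
      by (simp only: out_do_trt_def out_sur[OF that])
  qed
  have do_trt: "\<P>(\<omega> in pr P. out_do_trt P 0 \<omega> = 1) =
      mass (joint_law P) (\<lambda>a b c d. (if c = 0 then a else b) = 1)"
    "\<P>(\<omega> in pr P. out_do_trt P 1 \<omega> = 1) =
      mass (joint_law P) (\<lambda>a b c d. (if d = 0 then a else b) = 1)"
    unfolding prob_potential_event[OF wf, symmetric]
    by (rule arg_cong[of _ _ prob], rule Collect_cong, rule conj_cong[OF refl],
        simp only: do_t insert_iff simp_thms)+
  have nonneg: "0 \<le> joint_law P a b c d" for a b c d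
    by (simp add: joint_law_def)
  show ?thesis
    unfolding consistent_def has_observed_def ACE_SY_def ACE_TY_def p r do_sur do_trt
    using sum nonneg by blast
qed

section \<open>Realising a joint law by a process\<close>

text \<open>
  The lowest binary digit of the sample point is \<open>T\<close>, a fair coin; the remaining digits form \<open>U\<close>,
  which is distributed as \<open>Q\<close> and whose digits are \<open>Y\<^sub>0, Y\<^sub>1, S\<^sub>0, S\<^sub>1\<close>, from the lowest one upwards.
\<close>

definition bit_process :: "nat pmf \<Rightarrow> (nat, nat) process" where
  "bit_process Q =
     \<lparr>pr = measure_pmf (map_pmf (\<lambda>(t, u). of_bool t + 2 * u) (pair_pmf (bernoulli_pmf (1 / 2)) Q)),
      trt = (\<lambda>\<omega>. \<omega> mod 2),
      sur = (\<lambda>t \<omega>. \<omega> div 2 div 2 ^ (t + 2) mod 2),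
      out = (\<lambda>_ s \<omega>. \<omega> div 2 div 2 ^ s mod 2),
      cnf_space = count_space UNIV,
      cnf = (\<lambda>\<omega>. \<omega> div 2)\<rparr>"

text \<open>A condition on the lowest digit and one on the remaining digits form a rectangle for the
  product law.\<close>

lemma measure_bit_process:
  "measure (pr (bit_process Q)) {\<omega>. E (\<omega> mod 2) \<and> F (\<omega> div 2)} =
     measure (bernoulli_pmf (1 / 2)) {t. E (of_bool t)} * measure Q {u. F u}"
proof -
  have "(of_bool t + 2 * u) mod 2 = (of_bool t :: nat)" "(of_bool t + 2 * u) div 2 = u" for t and u :: nat
    by (cases t; simp)+
  then have "(\<lambda>(t, u). of_bool t + 2 * u) -` {\<omega>. E (\<omega> mod 2) \<and> F (\<omega> div 2)} = {t. E (of_bool t)} \<times> {u. F u}"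
    by auto
  then show ?thesis
    by (simp add: bit_process_def measure_pmf_prob_product)
qed

lemma mod_2_binary: "n mod 2 \<in> {0, 1 :: nat}"
  by auto

lemma wf_bit_process: "wf_process (bit_process Q)"
proof -
  have half: "measure (pr (bit_process Q)) {\<omega>. \<omega> mod 2 = 1} = 1 / 2"
  proof -
    have "{t. of_bool t = (1 :: nat)} = {True}" by auto
    then show ?thesis
      using measure_bit_process[of Q "\<lambda>t. t = 1" "\<lambda>_. True"]
      by (simp add: measure_pmf_single)
  qed
  show ?thesis
    using half mod_2_binary measure_pmf.prob_space_axioms
    by (simp add: wf_process_def bit_process_def)
qed

lemma space_bit_process [simp]: "space (pr (bit_process Q)) = UNIV" "sets (pr (bit_process Q)) = UNIV"
  by (simp_all add: bit_process_def)

lemma randomization_bit_process: "randomization (bit_process Q)"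
proof -
  let ?P = "bit_process Q"
  let ?Z = "\<lambda>\<omega>. (out_vec ?P \<omega>, sur_vec ?P \<omega>, cnf ?P \<omega>)"
  let ?C = "out_space \<Otimes>\<^sub>M (sur_space \<Otimes>\<^sub>M cnf_space ?P)"
  interpret prob_space "pr ?P" using wf_bit_process[of Q] by (simp add: wf_process_def)
  \<comment> \<open>The potential variables ignore the lowest digit, so \<open>2 * u\<close>
    represents both sample points with confounder \<open>u\<close>.\<close>
  define z where "z u = (out_vec ?P (2 * u), sur_vec ?P (2 * u), u)" for u
  have z: "?Z \<omega> = z (\<omega> div 2)" for \<omega>
    by (simp add: z_def out_vec_def sur_vec_def bit_process_def)
  have Z: "?Z \<in> UNIV \<rightarrow> space ?C"
    using measurable_space[OF measurable_potentials[OF wf_bit_process[of Q]]] by simp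
  have T: "trt ?P \<in> UNIV \<rightarrow> space binary"
    using mod_2_binary by (simp add: bit_process_def)
  show ?thesis
    unfolding randomization_def indep_rv_def space_bit_process
  proof (rule indep_setI)
    fix E F
    assume E: "E \<in> sets (vimage_algebra UNIV (trt ?P) binary)"
      and F: "F \<in> sets (vimage_algebra UNIV ?Z ?C)"
    from E obtain A where A: "E = trt ?P -` A"
      unfolding sets_vimage_algebra2[OF T] by auto
    from F obtain B where "F = ?Z -` B"
      unfolding sets_vimage_algebra2[OF Z] by auto
    with A have EF: "E = {\<omega>. \<omega> mod 2 \<in> A}" "F = {\<omega>. z (\<omega> div 2) \<in> B}"
      by (auto simp: z) (auto simp: bit_process_def)
    show "prob (E \<inter> F) = prob E * prob F"
      using measure_bit_process[of Q "\<lambda>t. t \<in> A" "\<lambda>u. z u \<in> B"]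
        measure_bit_process[of Q "\<lambda>t. t \<in> A" "\<lambda>_. True"]
        measure_bit_process[of Q "\<lambda>_. True" "\<lambda>u. z u \<in> B"]
      by (simp add: EF Collect_conj_eq)
  qed simp_all
qed

text \<open>Events determined by \<open>V\<close> are their own conditional expectations, and the
  indicator of an intersection is a product.\<close>

lemma (in prob_space) cond_indep_rv_if_determined:
  assumes V: "V \<in> M \<rightarrow>\<^sub>M C" and X: "X \<in> vimage_algebra (space M) V C \<rightarrow>\<^sub>M A"
    and Z: "Z \<in> vimage_algebra (space M) V C \<rightarrow>\<^sub>M B"
  shows "cond_indep_rv M A X B Z C V"
proof -
  let ?F = "vimage_algebra (space M) V C"
  have sub: "subalgebra M ?F"
    unfolding subalgebra_def using V by (auto simp: measurable_iff_sets)
  interpret sigma_finite_subalgebra M ?F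
    by (rule finite_measure_subalgebra_is_sigma_finite) (use sub in \<open>unfold_locales\<close>)
  have *: "AE \<omega> in M. real_cond_exp M ?F (indicator E) \<omega> = indicator E \<omega>" if "E \<in> sets ?F" for E
  proof (rule real_cond_exp_F_meas)
    have "E \<in> sets M" using that sub by (auto simp: subalgebra_def)
    then show "integrable M (indicator E :: _ \<Rightarrow> real)"
      by (simp add: emeasure_finite less_top[symmetric])
    show "indicator E \<in> borel_measurable ?F"
      using that by simp
  qed
  show ?thesis
    unfolding cond_indep_rv_def
  proof (intro ballI)
    fix E F
    assume "E \<in> sets (vimage_algebra (space M) X A)" "F \<in> sets (vimage_algebra (space M) Z B)"
    then have E: "E \<in> sets ?F" and F: "F \<in> sets ?F"
      using X Z by (auto simp: measurable_iff_sets)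
    show "AE \<omega> in M. real_cond_exp M ?F (indicator (E \<inter> F)) \<omega> =
        real_cond_exp M ?F (indicator E) \<omega> * real_cond_exp M ?F (indicator F) \<omega>"
      using *[OF E] *[OF F] *[OF sets.Int[OF E F]]
      by eventually_elim (simp add: indicator_inter_arith)
  qed
qed

lemma admissible_bit_process: "admissible (bit_process Q)"
proof -
  let ?P = "bit_process Q"
  let ?F = "vimage_algebra (space (pr ?P)) (cnf ?P) (cnf_space ?P)"
  interpret prob_space "pr ?P" using wf_bit_process[of Q] by (simp add: wf_process_def)
  have F: "cnf ?P \<in> ?F \<rightarrow>\<^sub>M cnf_space ?P"
    by (rule measurable_vimage_algebra1) (simp add: bit_process_def)
  have bits: "(\<lambda>\<omega>. \<omega> div 2 div k mod 2) \<in> ?F \<rightarrow>\<^sub>M binary" for k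
  proof -
    have "(\<lambda>u. u div k mod 2) \<in> cnf_space ?P \<rightarrow>\<^sub>M binary"
      using mod_2_binary by (simp add: bit_process_def)
    from measurable_compose[OF F this] show ?thesis
      by (simp add: bit_process_def)
  qed
  have "cond_indep_rv (pr ?P) sur_space (sur_vec ?P) out_space (out_vec ?P) (cnf_space ?P) (cnf ?P)"
  proof (rule cond_indep_rv_if_determined)
    show "cnf ?P \<in> pr ?P \<rightarrow>\<^sub>M cnf_space ?P"
      using wf_bit_process by (simp add: wf_process_def)
    show "sur_vec ?P \<in> ?F \<rightarrow>\<^sub>M sur_space"
      unfolding sur_vec_def using bits by (intro measurable_Pair) (simp_all add: bit_process_def)
    show "out_vec ?P \<in> ?F \<rightarrow>\<^sub>M out_space"
      unfolding out_vec_def using bits bits[of 1] by (intro measurable_Pair) (simp_all add: bit_process_def)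
  qed
  then show ?thesis
    by (simp add: admissible_def wf_bit_process randomization_bit_process strong_surrogate_def)
       (simp add: bit_process_def)
qed

lemma joint_law_bit_process:
  "joint_law (bit_process Q) a b c d =
     measure Q {u. u mod 2 = a \<and> u div 2 mod 2 = b \<and> u div 4 mod 2 = c \<and> u div 8 mod 2 = d}"
  using measure_bit_process[of Q "\<lambda>_. True"
      "\<lambda>u. u mod 2 = a \<and> u div 2 mod 2 = b \<and> u div 4 mod 2 = c \<and> u div 8 mod 2 = d"]
  by (simp add: joint_law_def bit_process_def)

lemma consistent_imp_process:
  assumes "consistent q p r \<gamma> \<delta>"
  shows "\<exists>P :: (nat, nat) process. admissible P \<and> has_observed P p r \<gamma> \<and> ACE_TY P = \<delta>"
proof -
  define xs where
    "xs = [(a + 2 * b + 4 * c + 8 * d, q a b c d). a \<leftarrow> [0, 1], b \<leftarrow> [0, 1], c \<leftarrow> [0, 1], d \<leftarrow> [0, 1]]"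
  have wf: "pmf_of_list_wf xs"
    using assms unfolding consistent_iff pmf_of_list_wf_def by (simp add: xs_def algebra_simps)
  have "joint_law (bit_process (pmf_of_list xs)) a b c d = q a b c d"
    if "a \<in> {0, 1}" "b \<in> {0, 1}" "c \<in> {0, 1}" "d \<in> {0, 1}" for a b c d
    unfolding joint_law_bit_process measure_pmf_of_list[OF wf]
    using that by (elim insertE emptyE; hypsubst) (simp_all add: xs_def)
  then have "mass (joint_law (bit_process (pmf_of_list xs))) \<phi> = mass q \<phi>" for \<phi>
    unfolding mass_def by (intro sum.cong refl if_cong) blast+
  then have "consistent (joint_law (bit_process (pmf_of_list xs))) p r \<gamma> \<delta>"
    using assms unfolding consistent_def by (simp add: joint_law_def)
  then show ?thesis
    using consistent_joint_law_iff[OF admissible_bit_process] admissible_bit_process by blast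
qed

theorem theorem1:
  fixes p :: "nat \<Rightarrow> nat \<Rightarrow> real" and r :: "nat \<Rightarrow> real" and \<gamma> :: real
  assumes "\<exists>P0 :: ('w0, 'u0) process. admissible P0 \<and> has_observed P0 p r \<gamma>"
  shows "(\<forall>P :: ('w, 'u) process. admissible P \<and> has_observed P p r \<gamma> \<longrightarrow>
            lower_bound p r \<gamma> \<le> ACE_TY P \<and> ACE_TY P \<le> upper_bound p r \<gamma>) \<and>
         (\<exists>P :: (nat, nat) process. admissible P \<and> has_observed P p r \<gamma> \<and>
            ACE_TY P = lower_bound p r \<gamma>) \<and>
         (\<exists>P :: (nat, nat) process. admissible P \<and> has_observed P p r \<gamma> \<and>
            ACE_TY P = upper_bound p r \<gamma>)"
proof -
  obtain q \<delta> where q: "consistent q p r \<gamma> \<delta>"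
    using assms consistent_joint_law_iff by blast
  obtain qL where qL: "consistent qL (\<lambda>y. p (1 - y)) r (- \<gamma>) (- lower_bound p r \<gamma>)"
    using upper_bound_attained[OF consistent_flip[OF q]]
    unfolding lower_bound_flip minus_minus by blast
  \<comment> \<open>Flipping twice restores \<open>p\<close> only on {0, 1}, which is all that
    \<open>consistent\<close> reads.\<close>
  have L: "consistent (\<lambda>a b. qL (1 - a) (1 - b)) p r \<gamma> (lower_bound p r \<gamma>)"
    using consistent_flip[OF qL] unfolding consistent_def by simp
  obtain qU where U: "consistent qU p r \<gamma> (upper_bound p r \<gamma>)"
    using upper_bound_attained[OF q] by blast
  have "lower_bound p r \<gamma> \<le> ACE_TY P \<and> ACE_TY P \<le> upper_bound p r \<gamma>"
    if "admissible P" "has_observed P p r \<gamma>" for P :: "('w, 'u) process"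
  proof -
    have P: "consistent (joint_law P) p r \<gamma> (ACE_TY P)"
      using that consistent_joint_law_iff by blast
    show ?thesis
      using consistent_le_upper_bound[OF P] consistent_le_upper_bound[OF consistent_flip[OF P]]
      by (simp add: lower_bound_flip)
  qed
  then show ?thesis
    using consistent_imp_process[OF L] consistent_imp_process[OF U] by blast
qed

end
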